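(* Let $\mathcal{H},\mathcal{K}$ be separable Hilbert spaces, let $(a_j)$ be a commuting sequence of normal operators on $\mathcal{H}$ and $(b_j)$ a commuting sequence of normal operators on $\mathcal{K}$, such that $\sum_j a_ja_j^*=1$ and $\sum_j b_j^*b_j=1$, the sums being weak* convergent. Let $\Theta$ be the map on $B(\mathcal{K},\mathcal{H})$ given by $\Theta(x)=\sum_j a_jxb_j$. Then the fixed points of $\Theta$ are precisely the operators $x\in B(\mathcal{K},\mathcal{H})$ satisfying $a_jx=xb_j^*$ for all $j$. *)

theory Defs
  imports "HOL-Analysis.Analysis"
begin

text \<open>A complex Hilbert space is encoded as a real Hilbert space (class real_inner +
complete_space) together with an orthogonal complex structure J (multiplication by i):
J is real-linear, J (J x) = - x, and J preserves the real inner product.  The complex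
inner product is then  inner x y + i * inner x (J y)  (up to convention), and its real
part is the real inner product.\<close>

definition complex_structure :: "('a::real_inner \<Rightarrow> 'a) \<Rightarrow> bool" where
  "complex_structure J \<longleftrightarrow> linear J \<and> (\<forall>x. J (J x) = - x) \<and> (\<forall>x y. inner (J x) (J y) = inner x y)"

definition separable :: "'a::topological_space itself \<Rightarrow> bool" where
  "separable _ \<longleftrightarrow> (\<exists>D::'a set. countable D \<and> closure D = UNIV)"

definition bounded_cop :: "('k::real_inner \<Rightarrow> 'k) \<Rightarrow> ('h::real_inner \<Rightarrow> 'h) \<Rightarrow> ('k \<Rightarrow> 'h) \<Rightarrow> bool" where
  "bounded_cop JK JH T \<longleftrightarrow> bounded_linear T \<and> (\<forall>x. T (JK x) = JH (T x))"

text \<open>Normal operator (the Hilbert adjoint of a complex-linear operator coincides with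
its adjoint for the real inner product).\<close>
definition normal_op :: "('a::real_inner \<Rightarrow> 'a) \<Rightarrow> bool" where
  "normal_op T \<longleftrightarrow> T \<circ> adjoint T = adjoint T \<circ> T"

text \<open>Weak-operator convergence of the series of operators T j to S.
(Partial sums in all uses below are norm-bounded, where weak* and WOT convergence
agree; also the real part of the complex pairing determines it.)\<close>
definition wot_sums :: "(nat \<Rightarrow> 'a \<Rightarrow> 'b::real_inner) \<Rightarrow> ('a \<Rightarrow> 'b) \<Rightarrow> bool" where
  "wot_sums T S \<longleftrightarrow> (\<forall>u v. (\<lambda>n. \<Sum>j<n. inner (T j u) v) \<longlonglongrightarrow> inner (S u) v)"

end

theory Submission
  imports Defs
begin

text \<open>If \<open>x\<close> is a fixed point, the commutators \<open>D\<^sub>i = a\<^sub>i x - x b\<^sub>i\<^sup>*\<close> are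
  fixed points too; this uses Fuglede's theorem for the \<open>b\<^sub>j\<close>. Expanding the squares gives
  \<open>\<Sum>\<^sub>i D\<^sub>i D\<^sub>i\<^sup>* = \<Psi>(x x\<^sup>*) - x x\<^sup>*\<close> for every fixed point \<open>x\<close>, where
  \<open>\<Psi>(y) = \<Sum>\<^sub>j a\<^sub>j y a\<^sub>j\<^sup>*\<close> is positive and unital. Hence
  \<open>\<Psi>(x x\<^sup>*) \<ge> x x\<^sup>* + D\<^sub>i D\<^sub>i\<^sup>*\<close> and \<open>\<Psi>(D\<^sub>i D\<^sub>i\<^sup>*) \<ge> D\<^sub>i D\<^sub>i\<^sup>*\<close>, so that
  \<open>n D\<^sub>i D\<^sub>i\<^sup>* \<le> \<Psi>\<^sup>n(x x\<^sup>*) \<le> \<parallel>x\<parallel>\<^sup>2\<close> for all \<open>n\<close>, which forces \<open>D\<^sub>i = 0\<close>.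

  Fuglede's theorem follows in the same way from the positive maps
  \<open>\<Phi>\<^sub>\<epsilon>(y) = (1 - \<epsilon>N\<^sup>*N) y (1 - \<epsilon>N\<^sup>*N) + \<epsilon>(N y N\<^sup>* + N\<^sup>* y N)\<close>, which are unital
  up to an error of order \<open>\<epsilon>\<^sup>2\<close>.\<close>

section \<open>Real inequalities and Riesz representation\<close>

lemma quadratic_nonneg_imp_linear_zero:
  fixes c d :: real
  assumes "\<And>t. 0 \<le> t * c + t\<^sup>2 * d"
  shows "c = 0"
proof (rule ccontr)
  assume c: "c \<noteq> 0"
  \<comment> \<open>Since \<open>e\<close> is positive and exceeds \<open>d\<close>, the quadratic
    is negative at \<open>t = - c / e\<close>.\<close>
  define e where "e = \<bar>d\<bar> + 1"
  have e: "e > 0" "d < e" by (auto simp: e_def)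
  have "0 \<le> (- c / e) * c + (- c / e)\<^sup>2 * d" by (rule assms)
  also have "\<dots> = c\<^sup>2 / e\<^sup>2 * (d - e)"
    using e by (simp add: field_simps power2_eq_square)
  also have "\<dots> < 0"
    using c e by (intro mult_pos_neg) auto
  finally show False by simp
qed

lemma bounded_multiples_nonpos:
  fixes c B :: real
  assumes "\<And>n. real n * c \<le> B"
  shows "c \<le> 0"
proof (rule ccontr)
  assume "\<not> c \<le> 0"
  then obtain n where "B < real n * c"
    using reals_Archimedean3[of c] by auto
  with assms[of n] show False by simp
qed

text \<open>The representing vector minimises \<open>\<parallel>y\<parallel>\<^sup>2 - 2 f y\<close>; minimising sequences are Cauchy by
  the parallelogram law.\<close>
theorem Riesz_representation:
  fixes f :: "'a::{real_inner,complete_space} \<Rightarrow> real"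
  assumes "bounded_linear f"
  shows "\<exists>w. \<forall>y. f y = inner w y"
proof -
  interpret f: bounded_linear f by fact
  obtain K where K: "\<And>y. norm (f y) \<le> norm y * K" using f.bounded by blast
  define g where "g y = (norm y)\<^sup>2 - 2 * f y" for y
  have low: "- K\<^sup>2 \<le> g y" for y
  proof -
    have "0 \<le> (norm y - K)\<^sup>2" by simp
    then show ?thesis using K[of y] by (simp add: g_def power2_diff)
  qed
  define m where "m = (INF y. g y)"
  have bdd: "bdd_below (range g)" using low by (auto intro!: bdd_belowI)
  have m: "m \<le> g y" for y unfolding m_def by (rule cINF_lower[OF bdd]) simp
  have "\<exists>y. g y < m + inverse (real (Suc n))" for n
    using cINF_less_iff[OF _ bdd, of "m + inverse (real (Suc n))"] by (simp add: m_def)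
  then obtain y where y: "\<And>n. g (y n) < m + inverse (real (Suc n))" by metis
  \<comment> \<open>At the midpoint \<open>w\<close> the linear terms cancel;
    \<open>m \<le> g w\<close> turns the parallelogram law into this bound.\<close>
  have par: "(norm (u - v))\<^sup>2 \<le> 2 * (g u - m) + 2 * (g v - m)" for u v
  proof -
    define w where "w = (1/2) *\<^sub>R (u + v)"
    have "g u + g v - 2 * g w = (1/2) * (norm (u - v))\<^sup>2"
      unfolding g_def w_def power2_norm_eq_inner
      by (simp add: f.add f.scaleR inner_simps inner_commute algebra_simps)
    then show ?thesis using m[of w] by argo
  qed
  have "Cauchy y"
  proof (rule metric_CauchyI)
    fix e :: real assume e: "e > 0"
    obtain M where M: "inverse (real (Suc M)) < e\<^sup>2 / 4"
      using reals_Archimedean[of "e\<^sup>2 / 4"] e by auto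
    show "\<exists>M. \<forall>p\<ge>M. \<forall>q\<ge>M. dist (y p) (y q) < e"
    proof (intro exI allI impI)
      fix p q assume pq: "p \<ge> M" "q \<ge> M"
      have "inverse (real (Suc p)) \<le> inverse (real (Suc M))"
        "inverse (real (Suc q)) \<le> inverse (real (Suc M))"
        using pq by (auto intro!: le_imp_inverse_le)
      then have "(norm (y p - y q))\<^sup>2 < e\<^sup>2"
        using par[of "y p" "y q"] y[of p] y[of q] M by argo
      then show "dist (y p) (y q) < e"
        using e by (simp add: dist_norm power2_less_imp_less)
    qed
  qed
  then obtain w where w: "y \<longlonglongrightarrow> w" using Cauchy_convergent convergent_def by blast
  have "(\<lambda>n. g (y n)) \<longlonglongrightarrow> g w"
    unfolding g_def by (intro tendsto_intros w f.tendsto)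
  moreover have "(\<lambda>n. m + inverse (real (Suc n))) \<longlonglongrightarrow> m + 0"
    by (intro tendsto_add tendsto_const LIMSEQ_inverse_real_of_nat)
  ultimately have gw: "g w \<le> m"
    using y by (intro LIMSEQ_le[of "\<lambda>n. g (y n)"]) (auto intro: less_imp_le)
  show ?thesis
  proof (intro exI allI)
    fix h
    \<comment> \<open>First variation of \<open>g\<close> at its minimiser \<open>w\<close> in
      direction \<open>h\<close>.\<close>
    have "0 \<le> t * (2 * (inner w h - f h)) + t\<^sup>2 * (norm h)\<^sup>2" for t
    proof -
      have "g (w + t *\<^sub>R h) = g w + t * (2 * (inner w h - f h)) + t\<^sup>2 * (norm h)\<^sup>2"
        unfolding g_def power2_norm_eq_inner
        by (simp add: f.add f.scaleR inner_simps inner_commute algebra_simps power2_eq_square)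
      then show ?thesis using m[of "w + t *\<^sub>R h"] gw by linarith
    qed
    then have "2 * (inner w h - f h) = 0" by (rule quadratic_nonneg_imp_linear_zero)
    then show "f h = inner w h" by simp
  qed
qed

section \<open>Adjoints of bounded operators\<close>

text \<open>\<open>adjoint\<close> is a Hilbert choice, so its defining identity holds once some
  adjoint exists; Riesz supplies one pointwise in \<open>v\<close>.\<close>

lemma adjoint_inner:
  fixes T :: "'a::{real_inner,complete_space} \<Rightarrow> 'b::real_inner"
  assumes "bounded_linear T"
  shows "inner (T u) v = inner u (adjoint T v)"
proof -
  have "\<exists>w. \<forall>u. inner (T u) v = inner w u" for v
    by (rule Riesz_representation)
      (rule bounded_linear_compose[OF bounded_linear_inner_left assms])
  then have "\<exists>T'. \<forall>u v. inner (T u) v = inner u (T' v)"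
    by (metis inner_commute)
  then have "\<forall>u v. inner (T u) v = inner u (adjoint T v)"
    unfolding adjoint_def by (rule someI_ex)
  then show ?thesis by blast
qed

lemma bounded_linear_adjoint:
  fixes T :: "'a::{real_inner,complete_space} \<Rightarrow> 'b::real_inner"
  assumes "bounded_linear T"
  shows "bounded_linear (adjoint T)"
proof -
  note ad = adjoint_inner[OF assms, symmetric]
  obtain K where K: "\<And>u. norm (T u) \<le> norm u * K" "K > 0"
    using bounded_linear.pos_bounded[OF assms] by blast
  show ?thesis
  proof (rule bounded_linear_intro)
    show "adjoint T (u + v) = adjoint T u + adjoint T v" for u v
      by (rule vector_eq_rdot[THEN iffD1]) (simp add: ad inner_simps inner_commute[of _ "_ :: 'a"])
    show "adjoint T (r *\<^sub>R u) = r *\<^sub>R adjoint T u" for r u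
      by (rule vector_eq_rdot[THEN iffD1]) (simp add: ad inner_simps inner_commute[of _ "_ :: 'a"])
    fix v
    have "norm (adjoint T v) * norm (adjoint T v) = inner (T (adjoint T v)) v"
      by (simp add: ad[symmetric] power2_norm_eq_inner[symmetric] power2_eq_square)
    also have "\<dots> \<le> norm (T (adjoint T v)) * norm v" by (rule norm_cauchy_schwarz)
    also have "\<dots> \<le> norm (adjoint T v) * (norm v * K)"
      using mult_right_mono[OF K(1)[of "adjoint T v"] norm_ge_zero[of v]] by (simp add: mult_ac)
    finally show "norm (adjoint T v) \<le> norm v * K"
      using K(2) by (cases "norm (adjoint T v) = 0") (auto simp: mult_le_cancel_left)
  qed
qed

lemma bounded_linear_norm_power2_le:
  assumes "bounded_linear T"
  obtains C where "C \<ge> 0" "\<And>v. (norm (T v))\<^sup>2 \<le> C * (norm v)\<^sup>2"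
proof -
  obtain K where K: "\<And>u. norm (T u) \<le> norm u * K"
    using bounded_linear.bounded[OF assms] by blast
  have "(norm (T v))\<^sup>2 \<le> K\<^sup>2 * (norm v)\<^sup>2" for v
    using power_mono[OF K[of v], of 2] by (simp add: power_mult_distrib mult_ac)
  then show thesis using that[of "K\<^sup>2"] by simp
qed

section \<open>Fuglede's theorem\<close>

lemma norm_diff_power2:
  fixes u v :: "'a::real_inner"
  shows "(norm (u - v))\<^sup>2 = (norm u)\<^sup>2 - 2 * inner u v + (norm v)\<^sup>2"
  unfolding power2_norm_eq_inner by (simp add: inner_simps inner_commute)

text \<open>The left side is the quadratic form of
  \<open>\<Phi>\<^sub>\<epsilon>(T\<^sup>*T)\<close> at \<open>v\<close>, with
  \<open>\<epsilon> = e\<close>. Normality gives |T N v| = |N T v| = |N' T v|, and the cross term is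
  -2e <N' T v, T N' v>, so a square is completed.\<close>

lemma normal_dissipation:
  fixes N N' T :: "'a::real_inner \<Rightarrow> 'a"
  assumes T: "linear T" and adj: "\<And>u v. inner (N u) v = inner u (N' v)"
    and normal: "\<And>v. N (N' v) = N' (N v)" and comm: "\<And>v. T (N v) = N (T v)"
  shows "(norm (T (v - e *\<^sub>R N (N' v))))\<^sup>2 + e * (norm (T (N v)))\<^sup>2 + e * (norm (T (N' v)))\<^sup>2
    = (norm (T v))\<^sup>2 + e * (norm (N' (T v) - T (N' v)))\<^sup>2 + e\<^sup>2 * (norm (N (T (N' v))))\<^sup>2"
proof -
  have T': "T (v - e *\<^sub>R N (N' v)) = T v - e *\<^sub>R N (T (N' v))"
    using T by (simp add: linear_diff linear_cmul comm)
  have "inner (T v) (N (T (N' v))) = inner (N' (T v)) (T (N' v))"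
    by (metis adj inner_commute)
  moreover have "(norm (N (T v)))\<^sup>2 = (norm (N' (T v)))\<^sup>2"
    unfolding power2_norm_eq_inner by (metis adj inner_commute normal)
  ultimately show ?thesis
    unfolding T'
    by (simp add: norm_diff_power2 comm power_mult_distrib algebra_simps)
qed

theorem Fuglede:
  fixes N N' T :: "'a::real_inner \<Rightarrow> 'a"
  assumes N: "bounded_linear N" and N': "bounded_linear N'" and T: "bounded_linear T"
    and adj: "\<And>u v. inner (N u) v = inner u (N' v)"
    and normal: "\<And>v. N (N' v) = N' (N v)" and comm: "\<And>v. T (N v) = N (T v)"
  shows "T (N' v) = N' (T v)"
proof -
  define D where "D v = N' (T v) - T (N' v)" for v
  have linN: "linear N" and linT: "linear T"
    using N T by (auto intro: bounded_linear.linear)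
  have D: "linear D"
    unfolding D_def using N' T
    by (intro bounded_linear.linear bounded_linear_sub bounded_linear_compose[of N' T]
        bounded_linear_compose[of T N'])
  \<comment> \<open>Thus \<open>normal_dissipation\<close> applies to \<open>D\<close> as well as to
    \<open>T\<close>.\<close>
  have Dcomm: "D (N v) = N (D v)" for v
    by (simp add: D_def comm normal[symmetric] linear_diff[OF linN])
  obtain C where C: "C \<ge> 0" "\<And>v. (norm (T v))\<^sup>2 \<le> C * (norm v)\<^sup>2"
    using bounded_linear_norm_power2_le[OF T] by blast
  obtain m where m: "m \<ge> 0" "\<And>v. (norm (N (N' v)))\<^sup>2 \<le> m * (norm v)\<^sup>2"
    using bounded_linear_norm_power2_le[OF bounded_linear_compose[OF N N']] by blast
  \<comment> \<open>Each application of \<open>\<Phi>\<^sub>\<epsilon>\<close> gains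
    \<open>e * (norm (D v))\<^sup>2\<close> and costs a factor \<open>1 + e\<^sup>2 * m\<close>. The
    vector stays arbitrary because the form is then evaluated at three other vectors.\<close>
  have iter: "(norm (T v))\<^sup>2 + real n * e * (norm (D v))\<^sup>2 \<le> C * (1 + e\<^sup>2 * m) ^ n * (norm v)\<^sup>2"
    if e: "e > 0" for n e v
  proof (induction n arbitrary: v)
    case 0
    show ?case using C by simp
  next
    case (Suc n)
    define q where "q v = (norm (T v))\<^sup>2 + real n * e * (norm (D v))\<^sup>2" for v
    let ?\<Phi> = "\<lambda>q. q (v - e *\<^sub>R N (N' v)) + e * q (N v) + e * q (N' v)"
    let ?c = "C * (1 + e\<^sup>2 * m) ^ n"
    have c: "?c \<ge> 0" using C m by simp
    have "(norm (T v))\<^sup>2 + e * (norm (D v))\<^sup>2 \<le> ?\<Phi> (\<lambda>v. (norm (T v))\<^sup>2)"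
      using normal_dissipation[OF linT adj normal comm, of v e] by (simp add: D_def)
    moreover have "(norm (D v))\<^sup>2 \<le> ?\<Phi> (\<lambda>v. (norm (D v))\<^sup>2)"
      using normal_dissipation[OF D adj normal Dcomm, of v e] e by simp
    then have "real n * e * (norm (D v))\<^sup>2 \<le> real n * e * ?\<Phi> (\<lambda>v. (norm (D v))\<^sup>2)"
      using e by (intro mult_left_mono) auto
    ultimately have "(norm (T v))\<^sup>2 + real (Suc n) * e * (norm (D v))\<^sup>2 \<le> ?\<Phi> q"
      by (simp add: q_def algebra_simps)
    also have "\<dots> \<le> ?\<Phi> (\<lambda>v. ?c * (norm v)\<^sup>2)"
      using e Suc.IH by (intro add_mono mult_left_mono) (auto simp: q_def)
    also have "\<dots> = ?c * ?\<Phi> (\<lambda>v. (norm v)\<^sup>2)"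
      by (simp add: distrib_left mult.left_commute)
    \<comment> \<open>The case \<open>T = id\<close>: the commutator term vanishes, leaving the
      defect from unitality.\<close>
    also have "?\<Phi> (\<lambda>v. (norm v)\<^sup>2) = (norm v)\<^sup>2 + e\<^sup>2 * (norm (N (N' v)))\<^sup>2"
      using normal_dissipation[OF linear_id adj normal, of v e] by simp
    also have "?c * \<dots> \<le> ?c * ((norm v)\<^sup>2 + e\<^sup>2 * (m * (norm v)\<^sup>2))"
      using c m by (intro mult_left_mono add_mono) auto
    also have "\<dots> = C * (1 + e\<^sup>2 * m) ^ Suc n * (norm v)\<^sup>2"
      by (simp add: algebra_simps)
    finally show ?case .
  qed
  \<comment> \<open>Take \<open>e = 1 / k\<close> and \<open>n = k\<^sup>2\<close>: the gain
    \<open>n * e = k\<close> is unbounded, while the accumulated factor stays below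
    \<open>exp m\<close>.\<close>
  have "real k * (norm (D v))\<^sup>2 \<le> C * exp m * (norm v)\<^sup>2" for k
  proof (cases "k = 0")
    case False
    then have k: "k > 0" by simp
    have "real k * (norm (D v))\<^sup>2 \<le> (norm (T v))\<^sup>2 + real (k\<^sup>2) * (1 / real k) * (norm (D v))\<^sup>2"
      using k by (simp add: power2_eq_square)
    also have "\<dots> \<le> C * (1 + (1 / real k)\<^sup>2 * m) ^ k\<^sup>2 * (norm v)\<^sup>2"
      using k by (intro iter) simp
    also have "(1 + (1 / real k)\<^sup>2 * m) ^ k\<^sup>2 \<le> exp ((1 / real k)\<^sup>2 * m) ^ k\<^sup>2"
      using m by (intro power_mono exp_ge_add_one_self) (auto intro: add_nonneg_nonneg)
    also have "\<dots> = exp m"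
      using k by (simp add: exp_of_nat_mult[symmetric] power_divide)
    finally show ?thesis using C by (simp add: mult_left_mono mult_right_mono)
  qed (use C in simp)
  then have "(norm (D v))\<^sup>2 \<le> 0"
    by (rule bounded_multiples_nonpos)
  then show ?thesis by (simp add: D_def)
qed

section \<open>Fixed points and intertwining operators\<close>

text \<open>With w = y* v, each summand expands to 2 <y* a_j* v, b_j w> - |b_j w|^2; the fixed-point
  equation sums the first part to 2 |w|^2 and \<open>bsum\<close> the second to |w|^2. Keeping the
  difference avoids proving that either series of squares converges alone.\<close>

lemma fixed_point_dissipation:
  fixes a :: "nat \<Rightarrow> 'h::{real_inner,complete_space} \<Rightarrow> 'h"
    and b :: "nat \<Rightarrow> 'k::{real_inner,complete_space} \<Rightarrow> 'k"
  assumes a: "\<And>j. bounded_linear (a j)" and b: "\<And>j. bounded_linear (b j)"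
    and y: "bounded_linear y"
    and bsum: "wot_sums (\<lambda>j. adjoint (b j) \<circ> b j) id"
    and fixp: "wot_sums (\<lambda>j. a j \<circ> y \<circ> b j) y"
  shows "(\<lambda>n. \<Sum>j<n. (norm (adjoint y (adjoint (a j) v)))\<^sup>2
      - (norm (adjoint y (adjoint (a j) v) - b j (adjoint y v)))\<^sup>2)
    \<longlonglongrightarrow> (norm (adjoint y v))\<^sup>2"
proof -
  define w where "w = adjoint y v"
  note ad = adjoint_inner[symmetric]
  have "(\<lambda>n. \<Sum>j<n. inner (adjoint (b j) (b j w)) w) \<longlonglongrightarrow> inner w w"
    using bsum by (simp add: wot_sums_def)
  moreover have "inner (adjoint (b j) (b j w)) w = (norm (b j w))\<^sup>2" for j
    using ad[OF b, of w j "b j w"] by (simp add: inner_commute power2_norm_eq_inner)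
  ultimately have 1: "(\<lambda>n. \<Sum>j<n. (norm (b j w))\<^sup>2) \<longlonglongrightarrow> (norm w)\<^sup>2"
    by (simp add: power2_norm_eq_inner)
  have "(\<lambda>n. \<Sum>j<n. inner (a j (y (b j w))) v) \<longlonglongrightarrow> inner (y w) v"
    using fixp by (simp add: wot_sums_def)
  moreover have "inner (a j (y (b j w))) v = inner (adjoint y (adjoint (a j) v)) (b j w)" for j
    by (simp add: adjoint_inner[OF a] adjoint_inner[OF y] inner_commute[of "b j w"])
  moreover have "inner (y w) v = (norm w)\<^sup>2"
    by (simp add: adjoint_inner[OF y] w_def power2_norm_eq_inner)
  ultimately have 2: "(\<lambda>n. \<Sum>j<n. inner (adjoint y (adjoint (a j) v)) (b j w)) \<longlonglongrightarrow> (norm w)\<^sup>2"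
    by simp
  have "(\<lambda>n. 2 * (\<Sum>j<n. inner (adjoint y (adjoint (a j) v)) (b j w)) - (\<Sum>j<n. (norm (b j w))\<^sup>2))
      \<longlonglongrightarrow> 2 * (norm w)\<^sup>2 - (norm w)\<^sup>2"
    by (intro tendsto_intros 1 2)
  then show ?thesis
    by (simp add: norm_diff_power2 w_def[symmetric] sum_distrib_left sum_subtractf[symmetric])
qed

lemma fixed_point_imp_intertwines:
  fixes a :: "nat \<Rightarrow> 'h::{real_inner,complete_space} \<Rightarrow> 'h"
    and b :: "nat \<Rightarrow> 'k::{real_inner,complete_space} \<Rightarrow> 'k"
  assumes a: "\<And>j. bounded_linear (a j)" and b: "\<And>j. bounded_linear (b j)"
    and x: "bounded_linear x"
    and acomm: "\<And>j v. a j (a i v) = a i (a j v)"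
    and bcomm: "\<And>j v. b j (adjoint (b i) v) = adjoint (b i) (b j v)"
    and asum: "wot_sums (\<lambda>j. a j \<circ> adjoint (a j)) id"
    and bsum: "wot_sums (\<lambda>j. adjoint (b j) \<circ> b j) id"
    and fixp: "wot_sums (\<lambda>j. a j \<circ> x \<circ> b j) x"
  shows "a i (x u) = x (adjoint (b i) u)"
proof -
  define D where "D u = a i (x u) - x (adjoint (b i) u)" for u
  have D: "bounded_linear D"
    unfolding D_def
    by (intro bounded_linear_sub bounded_linear_compose[OF a x]
        bounded_linear_compose[OF x bounded_linear_adjoint[OF b]])
  have adjD: "adjoint D v = adjoint x (adjoint (a i) v) - b i (adjoint x v)" for v
  proof -
    have "inner (adjoint (b i) u) w = inner u (b i w)" for u w
      using adjoint_inner[OF b, of i w u] by (simp add: inner_commute)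
    then have "adjoint D = (\<lambda>v. adjoint x (adjoint (a i) v) - b i (adjoint x v))"
      by (intro adjoint_unique)
        (simp add: D_def inner_diff_left inner_diff_right adjoint_inner[OF a] adjoint_inner[OF x])
    then show ?thesis by simp
  qed
  \<comment> \<open>Since \<open>a i\<close> commutes with \<open>a j\<close> and
    \<open>adjoint (b i)\<close> with \<open>b j\<close>, both outer factors move onto the test
    vectors, leaving two instances of \<open>fixp\<close>.\<close>
  have Dfix: "wot_sums (\<lambda>j. a j \<circ> D \<circ> b j) D"
    unfolding wot_sums_def
  proof (intro allI)
    fix u v
    have "(\<lambda>n. (\<Sum>j<n. inner (a j (x (b j u))) (adjoint (a i) v))
        - (\<Sum>j<n. inner (a j (x (b j (adjoint (b i) u)))) v))
      \<longlonglongrightarrow> inner (x u) (adjoint (a i) v) - inner (x (adjoint (b i) u)) v"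
      using fixp by (intro tendsto_diff) (simp_all add: wot_sums_def)
    moreover have "inner (a j (x (b j u))) (adjoint (a i) v)
        - inner (a j (x (b j (adjoint (b i) u)))) v = inner ((a j \<circ> D \<circ> b j) u) v" for j
      by (simp add: D_def bcomm acomm adjoint_inner[OF a, symmetric] inner_diff_left
          linear_diff[OF bounded_linear.linear[OF a]])
    ultimately show "(\<lambda>n. \<Sum>j<n. inner ((a j \<circ> D \<circ> b j) u) v) \<longlonglongrightarrow> inner (D u) v"
      by (simp add: D_def inner_diff_left adjoint_inner[OF a, symmetric] sum_subtractf[symmetric])
  qed
  obtain C where C: "C \<ge> 0" "\<And>v. (norm (adjoint x v))\<^sup>2 \<le> C * (norm v)\<^sup>2"
    using bounded_linear_norm_power2_le[OF bounded_linear_adjoint[OF x]] by blast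
  \<comment> \<open>In operator form, \<open>x x\<^sup>* + n D D\<^sup>* \<le> C\<close>; the step
    applies \<open>\<Psi>\<close> to this inequality.\<close>
  have iter: "(norm (adjoint x v))\<^sup>2 + real n * (norm (adjoint D v))\<^sup>2 \<le> C * (norm v)\<^sup>2" for n v
  proof (induction n arbitrary: v)
    case 0
    show ?case using C by simp
  next
    case (Suc n)
    define p where "p j = (norm (adjoint x (adjoint (a j) v)))\<^sup>2" for j
    define p' where "p' j = (norm (adjoint x (adjoint (a j) v) - b j (adjoint x v)))\<^sup>2" for j
    define q where "q j = (norm (adjoint D (adjoint (a j) v)))\<^sup>2" for j
    define q' where "q' j = (norm (adjoint D (adjoint (a j) v) - b j (adjoint D v)))\<^sup>2" for j
    have p: "(\<lambda>N. \<Sum>j<N. p j - p' j) \<longlonglongrightarrow> (norm (adjoint x v))\<^sup>2"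
      unfolding p_def p'_def by (rule fixed_point_dissipation[OF a b x bsum fixp])
    have q: "(\<lambda>N. \<Sum>j<N. q j - q' j) \<longlonglongrightarrow> (norm (adjoint D v))\<^sup>2"
      unfolding q_def q'_def by (rule fixed_point_dissipation[OF a b D bsum Dfix])
    have "(\<lambda>N. \<Sum>j<N. inner (a j (adjoint (a j) v)) v) \<longlonglongrightarrow> inner v v"
      using asum by (simp add: wot_sums_def)
    then have r: "(\<lambda>N. \<Sum>j<N. (norm (adjoint (a j) v))\<^sup>2) \<longlonglongrightarrow> (norm v)\<^sup>2"
      by (simp add: adjoint_inner[OF a] power2_norm_eq_inner)
    \<comment> \<open>Only partial sums with \<open>N > i\<close> contain the term
      \<open>p' i\<close>, which equals \<open>(norm (adjoint D v))\<^sup>2\<close>; the other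
      \<open>p' j\<close> are nonnegative.\<close>
    have "(\<Sum>j<N. p j - p' j) + (norm (adjoint D v))\<^sup>2 + real n * (\<Sum>j<N. q j - q' j)
        \<le> C * (\<Sum>j<N. (norm (adjoint (a j) v))\<^sup>2)" if "N > i" for N
    proof -
      have "(norm (adjoint D v))\<^sup>2 = p' i" by (simp add: adjD p'_def)
      also have "\<dots> \<le> (\<Sum>j<N. p' j)"
        using that by (intro member_le_sum) (auto simp: p'_def)
      finally have "(\<Sum>j<N. p j - p' j) + (norm (adjoint D v))\<^sup>2 \<le> (\<Sum>j<N. p j)"
        by (simp add: sum_subtractf)
      moreover have "real n * (\<Sum>j<N. q j - q' j) \<le> real n * (\<Sum>j<N. q j)"
        by (intro mult_left_mono sum_mono) (auto simp: q'_def)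
      \<comment> \<open>The induction hypothesis is used at each vector
        \<open>adjoint (a j) v\<close>.\<close>
      moreover have "(\<Sum>j<N. p j) + real n * (\<Sum>j<N. q j) \<le> (\<Sum>j<N. C * (norm (adjoint (a j) v))\<^sup>2)"
        using Suc.IH unfolding p_def q_def sum_distrib_left sum.distrib[symmetric]
        by (intro sum_mono) simp
      ultimately show ?thesis by (simp add: sum_distrib_left)
    qed
    then have "(norm (adjoint x v))\<^sup>2 + (norm (adjoint D v))\<^sup>2 + real n * (norm (adjoint D v))\<^sup>2
        \<le> C * (norm v)\<^sup>2"
      by (intro LIMSEQ_le[OF tendsto_add[OF tendsto_add[OF p tendsto_const]
              tendsto_mult[OF tendsto_const q]] tendsto_mult[OF tendsto_const r]])
        (auto intro: exI[of _ "Suc i"])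
    then show ?case by (simp add: algebra_simps)
  qed
  have "adjoint D v = 0" for v
  proof -
    have "real n * (norm (adjoint D v))\<^sup>2 \<le> C * (norm v)\<^sup>2" for n
      using iter[of v n] zero_le_power2[of "norm (adjoint x v)"] by linarith
    then have "(norm (adjoint D v))\<^sup>2 \<le> 0" by (rule bounded_multiples_nonpos)
    then show ?thesis by simp
  qed
  then have "inner (D u) (D u) = 0" by (simp add: adjoint_inner[OF D])
  then show ?thesis by (simp add: D_def)
qed

text \<open>Substituting \<open>inter\<close> turns the series into that of \<open>bsum\<close>,
  tested against \<open>adjoint x v\<close>.\<close>

lemma intertwines_imp_fixed_point:
  fixes x :: "'k::{real_inner,complete_space} \<Rightarrow> 'h::real_inner"
  assumes x: "bounded_linear x"
    and bsum: "wot_sums (\<lambda>j. adjoint (b j) \<circ> b j) id"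
    and inter: "\<And>j. a j \<circ> x = x \<circ> adjoint (b j)"
  shows "wot_sums (\<lambda>j. a j \<circ> x \<circ> b j) x"
  using bsum by (simp add: wot_sums_def inter adjoint_inner[OF x])

theorem theorem4p6:
  fixes JH :: "'h::{real_inner,complete_space} \<Rightarrow> 'h"
    and JK :: "'k::{real_inner,complete_space} \<Rightarrow> 'k"
    and a :: "nat \<Rightarrow> 'h \<Rightarrow> 'h"
    and b :: "nat \<Rightarrow> 'k \<Rightarrow> 'k"
  assumes "separable TYPE('h)" and "separable TYPE('k)"
    and "complex_structure JH" and "complex_structure JK"
    and "\<forall>j. bounded_cop JH JH (a j) \<and> normal_op (a j)"
    and "\<forall>i j. a i \<circ> a j = a j \<circ> a i"
    and "\<forall>j. bounded_cop JK JK (b j) \<and> normal_op (b j)"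
    and "\<forall>i j. b i \<circ> b j = b j \<circ> b i"
    and "wot_sums (\<lambda>j. a j \<circ> adjoint (a j)) id"
    and "wot_sums (\<lambda>j. adjoint (b j) \<circ> b j) id"
    and "bounded_cop JK JH x"
  shows "wot_sums (\<lambda>j. a j \<circ> x \<circ> b j) x \<longleftrightarrow> (\<forall>j. a j \<circ> x = x \<circ> adjoint (b j))"
proof -
  have a: "bounded_linear (a j)" and b: "bounded_linear (b j)" for j
    using assms(5,7) by (auto simp: bounded_cop_def)
  have x: "bounded_linear x" using assms(11) by (simp add: bounded_cop_def)
  have acomm: "a j (a i v) = a i (a j v)" for i j v
    using assms(6) by (metis comp_apply)
  \<comment> \<open>Fuglede with \<open>N = b i\<close> and \<open>T = b j\<close> upgrades
    commutation with \<open>b i\<close> to commutation with its adjoint.\<close>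
  have bcomm: "b j (adjoint (b i) v) = adjoint (b i) (b j v)" for i j v
  proof (rule Fuglede[OF b bounded_linear_adjoint[OF b] b adjoint_inner[OF b]])
    show "b i (adjoint (b i) v) = adjoint (b i) (b i v)" for v
      using assms(7) unfolding normal_op_def by (metis comp_apply)
    show "b j (b i v) = b i (b j v)" for v
      using assms(8) by (metis comp_apply)
  qed
  show ?thesis
  proof
    assume "wot_sums (\<lambda>j. a j \<circ> x \<circ> b j) x"
    from fixed_point_imp_intertwines[OF a b x acomm bcomm assms(9,10) this]
    show "\<forall>j. a j \<circ> x = x \<circ> adjoint (b j)" by auto
  next
    assume "\<forall>j. a j \<circ> x = x \<circ> adjoint (b j)"
    then show "wot_sums (\<lambda>j. a j \<circ> x \<circ> b j) x"
      by (intro intertwines_imp_fixed_point x assms(10)) simp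
  qed
qed

end
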